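(* For every $\varphi\in\mathcal{L}_{KB}$: $\mathsf{KB}\vdash\varphi$ if and only if $\varphi$ is valid in every epistemic neighborhood model (i.e. $\mathcal{M},w\models_n\varphi$ for every epistemic neighborhood model $\mathcal{M}$ and every world $w$ of $\mathcal{M}$).
   Context: Fix a set $\mathsf{Prop}$ of propositional letters. Language $\mathcal{L}_{KB}$: $\varphi::=\top\mid p\mid\neg\varphi\mid\varphi\wedge\varphi\mid K\varphi\mid B\varphi$, with Boolean abbreviations, $\check K:=\neg K\neg$, $\check B:=\neg B\neg$. Calculus $\mathsf{KB}$: axiom schemes (CL) classical propositional tautologies; (KS5) the $\mathsf{S5}$ schemes for $K$ ($K(\varphi\to\psi)\to(K\varphi\to K\psi)$, $K\varphi\to\varphi$, $K\varphi\to KK\varphi$, $\neg K\varphi\to K\neg K\varphi$); (BF) $\neg B\bot$; (N) $B\top$; (Ap) $B\varphi\to KB\varphi$; (An) $\neg B\varphi\to K\neg B\varphi$; (KBM) $K(\varphi\to\psi)\to(B\varphi\to B\psi)$; rules modus ponens and (MN) from $\varphi$ infer $K\varphi$. An epistemic neighborhood model is $\mathcal{M}=(W,R,V,N)$ with $W$ a finite nonempty set, $R$ an equivalence relation on $W$ (with classes $[w]$), $V:W\to\wp(\mathsf{Prop})$, and $N:W\to\wp(\wp(W))$ such that for all $w$: (kbc) $X\in N(w)\Rightarrow X\subseteq[w]$; (kbf) $\emptyset\notin N(w)$; (n) $[w]\in N(w)$; (a) $N(v)=N(w)$ for all $v\in[w]$; (kbm) $X\subseteq Y\subseteq[w]$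 and $X\in N(w)$ imply $Y\in N(w)$. Truth: $\mathcal{M},w\models_n p$ iff $p\in V(w)$; Boolean clauses standard; $\mathcal{M},w\models_n K\varphi$ iff $[w]\subseteq[\![\varphi]\!]$; $\mathcal{M},w\models_n B\varphi$ iff $[w]\cap[\![\varphi]\!]\in N(w)$, where $[\![\varphi]\!]=\{v\in W\mid\mathcal{M},v\models_n\varphi\}$. *)

theory Defs imports Main begin

datatype 'p form =
    Top ("\<^bold>\<top>")
  | Letter 'p
  | Neg "'p form" ("\<^bold>\<not> _" [70] 70)
  | And "'p form" "'p form" (infixr "\<^bold>\<and>" 65)
  | K "'p form"
  | B "'p form"

abbreviation Bot :: "'p form" ("\<^bold>\<bottom>") where
  "\<^bold>\<bottom> \<equiv> \<^bold>\<not> \<^bold>\<top>"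

abbreviation Imp :: "'p form \<Rightarrow> 'p form \<Rightarrow> 'p form" (infixr "\<^bold>\<longrightarrow>" 55) where
  "\<phi> \<^bold>\<longrightarrow> \<psi> \<equiv> \<^bold>\<not> (\<phi> \<^bold>\<and> \<^bold>\<not> \<psi>)"

text \<open>Classical tautologies of the modal language: the letters and the formulas
  \<open>K \<phi>\<close>, \<open>B \<phi>\<close> are treated as atoms, and \<open>h\<close> assigns truth values to these atoms.\<close>

primrec bool_eval :: "('p form \<Rightarrow> bool) \<Rightarrow> 'p form \<Rightarrow> bool" where
  "bool_eval h \<^bold>\<top> \<longleftrightarrow> True"
| "bool_eval h (Letter p) \<longleftrightarrow> h (Letter p)"
| "bool_eval h (\<^bold>\<not> \<phi>) \<longleftrightarrow> \<not> bool_eval h \<phi>"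
| "bool_eval h (\<phi> \<^bold>\<and> \<psi>) \<longleftrightarrow> bool_eval h \<phi> \<and> bool_eval h \<psi>"
| "bool_eval h (K \<phi>) \<longleftrightarrow> h (K \<phi>)"
| "bool_eval h (B \<phi>) \<longleftrightarrow> h (B \<phi>)"

definition tautology :: "'p form \<Rightarrow> bool" where
  "tautology \<phi> \<longleftrightarrow> (\<forall>h. bool_eval h \<phi>)"

inductive KB_derivable :: "'p form \<Rightarrow> bool" ("\<turnstile>\<^sub>K\<^sub>B _" [50] 50) where
  CL: "tautology \<phi> \<Longrightarrow> \<turnstile>\<^sub>K\<^sub>B \<phi>"
| KK: "\<turnstile>\<^sub>K\<^sub>B K (\<phi> \<^bold>\<longrightarrow> \<psi>) \<^bold>\<longrightarrow> (K \<phi> \<^bold>\<longrightarrow> K \<psi>)"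
| KT: "\<turnstile>\<^sub>K\<^sub>B K \<phi> \<^bold>\<longrightarrow> \<phi>"
| K4: "\<turnstile>\<^sub>K\<^sub>B K \<phi> \<^bold>\<longrightarrow> K (K \<phi>)"
| K5: "\<turnstile>\<^sub>K\<^sub>B \<^bold>\<not> K \<phi> \<^bold>\<longrightarrow> K (\<^bold>\<not> K \<phi>)"
| BF: "\<turnstile>\<^sub>K\<^sub>B \<^bold>\<not> B \<^bold>\<bottom>"
| N: "\<turnstile>\<^sub>K\<^sub>B B \<^bold>\<top>"
| Ap: "\<turnstile>\<^sub>K\<^sub>B B \<phi> \<^bold>\<longrightarrow> K (B \<phi>)"
| An: "\<turnstile>\<^sub>K\<^sub>B \<^bold>\<not> B \<phi> \<^bold>\<longrightarrow> K (\<^bold>\<not> B \<phi>)"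
| KBM: "\<turnstile>\<^sub>K\<^sub>B K (\<phi> \<^bold>\<longrightarrow> \<psi>) \<^bold>\<longrightarrow> (B \<phi> \<^bold>\<longrightarrow> B \<psi>)"
| MP: "\<turnstile>\<^sub>K\<^sub>B \<phi> \<^bold>\<longrightarrow> \<psi> \<Longrightarrow> \<turnstile>\<^sub>K\<^sub>B \<phi> \<Longrightarrow> \<turnstile>\<^sub>K\<^sub>B \<psi>"
| MN: "\<turnstile>\<^sub>K\<^sub>B \<phi> \<Longrightarrow> \<turnstile>\<^sub>K\<^sub>B K \<phi>"

text \<open>The set of worlds is an explicit carrier inside the type \<open>'w\<close>; the values of
  \<open>val\<close> and \<open>nbhd\<close> outside the carrier are irrelevant.\<close>

record ('w, 'p) nmodel =
  worlds :: "'w set"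
  rel :: "('w \<times> 'w) set"
  val :: "'w \<Rightarrow> 'p set"
  nbhd :: "'w \<Rightarrow> 'w set set"

definition cell :: "('w, 'p) nmodel \<Rightarrow> 'w \<Rightarrow> 'w set" where
  "cell M w = rel M `` {w}"

definition epistemic_nbhd_model :: "('w, 'p) nmodel \<Rightarrow> bool" where
  "epistemic_nbhd_model M \<longleftrightarrow>
     finite (worlds M) \<and> worlds M \<noteq> {} \<and>
     equiv (worlds M) (rel M) \<and>
     (\<forall>w\<in>worlds M.
        nbhd M w \<subseteq> Pow (worlds M) \<and>
        (\<forall>X\<in>nbhd M w. X \<subseteq> cell M w) \<and>
        {} \<notin> nbhd M w \<and>
        cell M w \<in> nbhd M w \<and>
        (\<forall>v\<in>cell M w. nbhd M v = nbhd M w) \<and>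
        (\<forall>X Y. X \<subseteq> Y \<and> Y \<subseteq> cell M w \<and> X \<in> nbhd M w \<longrightarrow> Y \<in> nbhd M w))"

primrec sat :: "('w, 'p) nmodel \<Rightarrow> 'w \<Rightarrow> 'p form \<Rightarrow> bool" ("_, _ \<Turnstile>\<^sub>n _" [51, 51, 50] 50) where
  "(M, w \<Turnstile>\<^sub>n \<^bold>\<top>) \<longleftrightarrow> True"
| "(M, w \<Turnstile>\<^sub>n Letter p) \<longleftrightarrow> p \<in> val M w"
| "(M, w \<Turnstile>\<^sub>n \<^bold>\<not> \<phi>) \<longleftrightarrow> \<not> (M, w \<Turnstile>\<^sub>n \<phi>)"
| "(M, w \<Turnstile>\<^sub>n \<phi> \<^bold>\<and> \<psi>) \<longleftrightarrow> (M, w \<Turnstile>\<^sub>n \<phi>) \<and> (M, w \<Turnstile>\<^sub>n \<psi>)"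
| "(M, w \<Turnstile>\<^sub>n K \<phi>) \<longleftrightarrow> cell M w \<subseteq> {v \<in> worlds M. M, v \<Turnstile>\<^sub>n \<phi>}"
| "(M, w \<Turnstile>\<^sub>n B \<phi>) \<longleftrightarrow> cell M w \<inter> {v \<in> worlds M. M, v \<Turnstile>\<^sub>n \<phi>} \<in> nbhd M w"

text \<open>HOL cannot quantify over types inside a formula, so validity is relative to the type
  from which the worlds are drawn. Worlds sets being finite, every epistemic
  neighborhood model is isomorphic to one with worlds in \<open>nat\<close>.\<close>

definition valid_over :: "'w itself \<Rightarrow> 'p form \<Rightarrow> bool" where
  "valid_over (_ :: 'w itself) \<phi> \<longleftrightarrow>
     (\<forall>M :: ('w, 'p) nmodel. epistemic_nbhd_model M \<longrightarrow> (\<forall>w\<in>worlds M. M, w \<Turnstile>\<^sub>n \<phi>))"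

end

(* Completeness: for a finite subformula-closed set S containing B Top and B Bot, take as worlds the
   consistent truth-value assignments to S, related when they agree on the K- and B-formulas of S.
   The conjunction of the modal literals of a world entails its own K-closure, by K4, K5, Ap and An;
   hence whatever holds in all worlds of a cell is provably known there. The neighborhoods of a world
   are the supersets, within its cell, of the truth sets of the formulas believed at that world. *)

theory Submission imports Defs begin

section \<open>Soundness\<close>

text \<open>Truth at a fixed world is itself a valuation of letters, \<open>K\<close>- and
  \<open>B\<close>-formulas that commutes with the connectives; hence tautologies hold at every
  world.\<close>

lemma sat_eq_bool_eval: "(M, w \<Turnstile>\<^sub>n \<phi>) \<longleftrightarrow> bool_eval (\<lambda>\<psi>. M, w \<Turnstile>\<^sub>n \<psi>) \<phi>"
  by (induction \<phi>) auto

text \<open>Cells and neighborhoods are constant on each cell, hence so are the truth values of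
  \<open>K\<close>- and \<open>B\<close>-formulas; this yields \<open>K4\<close>, \<open>K5\<close>,
  \<open>Ap\<close> and \<open>An\<close>. Upward closure inside the cell yields
  \<open>KBM\<close>.\<close>

lemma soundness:
  assumes "\<turnstile>\<^sub>K\<^sub>B \<phi>" and M: "epistemic_nbhd_model M" and "w \<in> worlds M"
  shows "M, w \<Turnstile>\<^sub>n \<phi>"
proof -
  have eq: "equiv (worlds M) (rel M)"
    using M by (simp add: epistemic_nbhd_model_def)
  have self: "w \<in> cell M w" if "w \<in> worlds M" for w
    unfolding cell_def using eq that by (rule equiv_class_self)
  have same: "cell M v = cell M w" if "v \<in> cell M w" for v w
    using equiv_class_eq[OF eq, of w v] that by (simp add: cell_def)
  have sub: "v \<in> worlds M" if "v \<in> cell M w" for v w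
    using equiv_type[OF eq] that by (auto simp: cell_def)
  have nsame: "nbhd M v = nbhd M w" if "v \<in> cell M w" "w \<in> worlds M" for v w
    using M that by (auto simp: epistemic_nbhd_model_def)
  have mono: "Y \<in> nbhd M w" if "X \<in> nbhd M w" "X \<subseteq> Y" "Y \<subseteq> cell M w" "w \<in> worlds M" for w X Y
    using M that unfolding epistemic_nbhd_model_def by blast
  have K_iff: "(M, w \<Turnstile>\<^sub>n K \<psi>) \<longleftrightarrow> (\<forall>v\<in>cell M w. M, v \<Turnstile>\<^sub>n \<psi>)" for w \<psi>
    using sub by auto
  have K_const: "(M, v \<Turnstile>\<^sub>n K \<psi>) \<longleftrightarrow> (M, w \<Turnstile>\<^sub>n K \<psi>)" if "v \<in> cell M w" for v w \<psi>
    by (simp add: same[OF that])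
  have B_const: "(M, v \<Turnstile>\<^sub>n B \<psi>) \<longleftrightarrow> (M, w \<Turnstile>\<^sub>n B \<psi>)"
    if "v \<in> cell M w" "w \<in> worlds M" for v w \<psi>
    by (simp add: same[OF that(1)] nsame[OF that])
  have B_mono: "M, w \<Turnstile>\<^sub>n B \<psi>"
    if "M, w \<Turnstile>\<^sub>n K (\<phi> \<^bold>\<longrightarrow> \<psi>)" "M, w \<Turnstile>\<^sub>n B \<phi>" "w \<in> worlds M" for w \<phi> \<psi>
  proof -
    have "cell M w \<inter> {v \<in> worlds M. M, v \<Turnstile>\<^sub>n \<phi>} \<subseteq> cell M w \<inter> {v \<in> worlds M. M, v \<Turnstile>\<^sub>n \<psi>}"
      using that(1) by auto
    then show ?thesis using mono[OF _ _ Int_lower1] that(2,3) unfolding sat.simps by blast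
  qed
  show ?thesis
    using assms(1,3)
  \<comment> \<open>\<open>MN\<close> needs the induction hypothesis at every world of the cell, so
    \<open>w\<close> is generalized.\<close>
  proof (induction arbitrary: w)
    case (CL \<phi>)
    then show ?case by (subst sat_eq_bool_eval) (simp add: tautology_def)
  next
    case (KT \<phi>)
    then show ?case using self K_iff by (metis sat.simps(3,4))
  next
    case (K4 \<phi>)
    then show ?case using K_iff K_const by (metis sat.simps(3,4))
  next
    case (K5 \<phi>)
    then show ?case using K_iff K_const by (metis sat.simps(3,4))
  next
    case BF
    then have "{} \<notin> nbhd M w" using M unfolding epistemic_nbhd_model_def by blast
    then show ?case by simp
  next
    case N
    then have "cell M w \<in> nbhd M w" using M unfolding epistemic_nbhd_model_def by blast
    moreover have "cell M w \<inter> worlds M = cell M w" using sub by blast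
    ultimately show ?case by simp
  next
    case (Ap \<phi>)
    then show ?case using K_iff B_const by (metis sat.simps(3,4))
  next
    case (An \<phi>)
    then show ?case using K_iff B_const by (metis sat.simps(3,4))
  next
    case (KBM \<phi> \<psi>)
    then show ?case using B_mono by (metis sat.simps(3,4))
  next
    case (MN \<phi>)
    then show ?case using sub by auto
  qed auto
qed

section \<open>Derivations\<close>

text \<open>The second assumption makes the implication from \<phi> to \<psi> an instance of
  \<open>CL\<close>. Propositional steps are thus checked on truth values.\<close>

lemma derive_taut1:
  assumes "\<turnstile>\<^sub>K\<^sub>B \<phi>" and "\<And>h. bool_eval h \<phi> \<Longrightarrow> bool_eval h \<psi>"
  shows "\<turnstile>\<^sub>K\<^sub>B \<psi>"
  using assms by (intro MP[OF CL assms(1)]) (simp add: tautology_def)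

lemma derive_taut2:
  assumes "\<turnstile>\<^sub>K\<^sub>B \<phi>" and "\<turnstile>\<^sub>K\<^sub>B \<chi>" and "\<And>h. bool_eval h \<phi> \<Longrightarrow> bool_eval h \<chi> \<Longrightarrow> bool_eval h \<psi>"
  shows "\<turnstile>\<^sub>K\<^sub>B \<psi>"
proof -
  have "\<turnstile>\<^sub>K\<^sub>B \<chi> \<^bold>\<longrightarrow> \<psi>" by (rule derive_taut1[OF assms(1)]) (use assms(3) in auto)
  then show ?thesis using assms(2) by (rule MP)
qed

lemma derive_K_mono:
  assumes "\<turnstile>\<^sub>K\<^sub>B \<phi> \<^bold>\<longrightarrow> \<psi>"
  shows "\<turnstile>\<^sub>K\<^sub>B K \<phi> \<^bold>\<longrightarrow> K \<psi>"
  using MP[OF KK MN[OF assms]] .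

primrec conjs :: "'p form list \<Rightarrow> 'p form" where
  "conjs [] = \<^bold>\<top>"
| "conjs (\<phi> # \<phi>s) = \<phi> \<^bold>\<and> conjs \<phi>s"

lemma bool_eval_conjs [simp]: "bool_eval h (conjs \<phi>s) \<longleftrightarrow> (\<forall>\<phi>\<in>set \<phi>s. bool_eval h \<phi>)"
  by (induction \<phi>s) auto

text \<open>A normal modality aggregates over finite conjunctions, so introspection passes from the
  conjuncts to the conjunction.\<close>

lemma conjs_imp_K_conjs:
  assumes "\<And>\<phi>. \<phi> \<in> set \<phi>s \<Longrightarrow> \<turnstile>\<^sub>K\<^sub>B \<phi> \<^bold>\<longrightarrow> K \<phi>"
  shows "\<turnstile>\<^sub>K\<^sub>B conjs \<phi>s \<^bold>\<longrightarrow> K (conjs \<phi>s)"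
  using assms
proof (induction \<phi>s)
  case Nil
  have "\<turnstile>\<^sub>K\<^sub>B K \<^bold>\<top>" by (rule MN, rule CL) (simp add: tautology_def)
  then show ?case by (rule derive_taut1) auto
next
  case (Cons \<phi> \<phi>s)
  have 1: "\<turnstile>\<^sub>K\<^sub>B conjs (\<phi> # \<phi>s) \<^bold>\<longrightarrow> (K \<phi> \<^bold>\<and> K (conjs \<phi>s))"
  proof (rule derive_taut2)
    show "\<turnstile>\<^sub>K\<^sub>B \<phi> \<^bold>\<longrightarrow> K \<phi>" using Cons.prems by simp
    show "\<turnstile>\<^sub>K\<^sub>B conjs \<phi>s \<^bold>\<longrightarrow> K (conjs \<phi>s)" using Cons by simp
  qed auto
  \<comment> \<open>Applying \<open>K\<close> to this curried tautology and then \<open>KK\<close>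
    to its inner implication moves \<open>K\<close> outside the conjunction.\<close>
  have "\<turnstile>\<^sub>K\<^sub>B \<phi> \<^bold>\<longrightarrow> (conjs \<phi>s \<^bold>\<longrightarrow> conjs (\<phi> # \<phi>s))"
    by (rule CL) (auto simp: tautology_def)
  then have 2: "\<turnstile>\<^sub>K\<^sub>B K \<phi> \<^bold>\<longrightarrow> K (conjs \<phi>s \<^bold>\<longrightarrow> conjs (\<phi> # \<phi>s))"
    by (rule derive_K_mono)
  have "\<turnstile>\<^sub>K\<^sub>B (K \<phi> \<^bold>\<and> K (conjs \<phi>s)) \<^bold>\<longrightarrow> K (conjs (\<phi> # \<phi>s))"
    by (rule derive_taut2[OF 2 KK]) auto
  with 1 show ?case by (rule derive_taut2) auto
qed

section \<open>Atoms\<close>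

text \<open>The set \<open>a\<close> codes a truth-value assignment to the members of
  \<open>l\<close>: those in \<open>a\<close> count as true. A list, unlike a set, determines the
  finite conjunction as a formula.\<close>

definition lits :: "'p form set \<Rightarrow> 'p form list \<Rightarrow> 'p form list" where
  "lits a l = map (\<lambda>s. if s \<in> a then s else \<^bold>\<not> s) l"

lemma bool_eval_lits [simp]:
  "(\<forall>\<phi>\<in>set (lits a l). bool_eval h \<phi>) \<longleftrightarrow> (\<forall>s\<in>set l. bool_eval h s \<longleftrightarrow> s \<in> a)"
  by (induction l) (simp_all add: lits_def)

definition consistent :: "'p form \<Rightarrow> bool" where
  "consistent \<theta> \<longleftrightarrow> \<not> (\<turnstile>\<^sub>K\<^sub>B \<^bold>\<not> \<theta>)"

lemma consistent_weaken:
  assumes "consistent \<theta>" and "\<And>h. bool_eval h \<theta> \<Longrightarrow> bool_eval h \<eta>"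
  shows "consistent \<eta>"
  using assms derive_taut1[of "\<^bold>\<not> \<eta>" "\<^bold>\<not> \<theta>"] by (auto simp: consistent_def)

text \<open>Otherwise \<phi> would propositionally imply the negation of \<theta>, and the theorem
  \<phi> would refute \<theta>.\<close>

lemma consistent_with_theorem:
  assumes "consistent \<theta>" and "\<turnstile>\<^sub>K\<^sub>B \<phi>"
  shows "\<exists>h. bool_eval h \<theta> \<and> bool_eval h \<phi>"
  using assms derive_taut1[of \<phi> "\<^bold>\<not> \<theta>"] by (auto simp: consistent_def)

text \<open>Finite Lindenbaum lemma. A consistent formula stays consistent with \<open>s\<close> or
  with its negation, since refuting both would refute it by cases.\<close>

lemma consistent_extend_lits:
  assumes "consistent \<theta>"
  shows "\<exists>a \<subseteq> set l. consistent (\<theta> \<^bold>\<and> conjs (lits a l))"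
  using assms
proof (induction l arbitrary: \<theta>)
  case Nil
  have "consistent (\<theta> \<^bold>\<and> conjs (lits {} []))"
    by (rule consistent_weaken[OF Nil]) (simp add: lits_def)
  then show ?case by auto
next
  case (Cons s l)
  obtain a where a: "a \<subseteq> set l" "consistent (\<theta> \<^bold>\<and> conjs (lits a l))"
    using Cons by blast
  show ?case
  proof (cases "s \<in> set l")
    case True
    \<comment> \<open>A repeated entry is already decided by the literals of the tail.\<close>
    have "consistent (\<theta> \<^bold>\<and> conjs (lits a (s # l)))"
      by (rule consistent_weaken[OF a(2)]) (use True in simp)
    then show ?thesis using a(1) by auto
  next
    case False
    let ?\<eta> = "\<theta> \<^bold>\<and> conjs (lits a l)"
    have "consistent (?\<eta> \<^bold>\<and> s) \<or> consistent (?\<eta> \<^bold>\<and> \<^bold>\<not> s)"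
    proof (rule ccontr)
      assume "\<not> ?thesis"
      then have "\<turnstile>\<^sub>K\<^sub>B \<^bold>\<not> (?\<eta> \<^bold>\<and> s)" "\<turnstile>\<^sub>K\<^sub>B \<^bold>\<not> (?\<eta> \<^bold>\<and> \<^bold>\<not> s)"
        by (auto simp: consistent_def)
      then have "\<turnstile>\<^sub>K\<^sub>B \<^bold>\<not> ?\<eta>" by (rule derive_taut2) auto
      then show False using a(2) by (simp add: consistent_def)
    qed
    then show ?thesis
    proof
      assume c: "consistent (?\<eta> \<^bold>\<and> s)"
      \<comment> \<open>As \<open>s\<close> does not occur in \<open>l\<close>, adding it to
        \<open>a\<close> leaves the literals of the tail unchanged.\<close>
      have "consistent (\<theta> \<^bold>\<and> conjs (lits (insert s a) (s # l)))"
        by (rule consistent_weaken[OF c]) (use False in auto)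
      moreover have "insert s a \<subseteq> set (s # l)" using a(1) by auto
      ultimately show ?thesis by blast
    next
      assume c: "consistent (?\<eta> \<^bold>\<and> \<^bold>\<not> s)"
      have "consistent (\<theta> \<^bold>\<and> conjs (lits a (s # l)))"
        by (rule consistent_weaken[OF c]) (use False a(1) in auto)
      then show ?thesis using a(1) by auto
    qed
  qed
qed

section \<open>Introspection of modal literals\<close>

primrec modal :: "'p form \<Rightarrow> bool" where
  "modal \<^bold>\<top> = False"
| "modal (Letter p) = False"
| "modal (\<^bold>\<not> \<phi>) = False"
| "modal (\<phi> \<^bold>\<and> \<psi>) = False"
| "modal (K \<phi>) = True"
| "modal (B \<phi>) = True"

lemma modal_lit_imp_K:
  assumes "modal s"
  shows "\<turnstile>\<^sub>K\<^sub>B s \<^bold>\<longrightarrow> K s" and "\<turnstile>\<^sub>K\<^sub>B \<^bold>\<not> s \<^bold>\<longrightarrow> K (\<^bold>\<not> s)"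
  using assms K4 Ap K5 An by (cases s; auto)+

text \<open>The formula describing the cell of \<open>a\<close>: a valuation satisfies it exactly
  when it matches \<open>a\<close> on the \<open>K\<close>- and \<open>B\<close>-formulas of
  \<open>l\<close>.\<close>

definition modal_part :: "'p form list \<Rightarrow> 'p form set \<Rightarrow> 'p form" where
  "modal_part l a = conjs (lits a (filter modal l))"

lemma modal_part_imp_K: "\<turnstile>\<^sub>K\<^sub>B modal_part l a \<^bold>\<longrightarrow> K (modal_part l a)"
  unfolding modal_part_def
  by (rule conjs_imp_K_conjs) (use modal_lit_imp_K in \<open>auto simp: lits_def\<close>)

section \<open>Subformula-closed lists and their atoms\<close>

primrec subforms :: "'p form \<Rightarrow> 'p form list" where
  "subforms \<^bold>\<top> = [\<^bold>\<top>]"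
| "subforms (Letter p) = [Letter p]"
| "subforms (\<^bold>\<not> \<phi>) = (\<^bold>\<not> \<phi>) # subforms \<phi>"
| "subforms (\<phi> \<^bold>\<and> \<psi>) = (\<phi> \<^bold>\<and> \<psi>) # subforms \<phi> @ subforms \<psi>"
| "subforms (K \<phi>) = K \<phi> # subforms \<phi>"
| "subforms (B \<phi>) = B \<phi> # subforms \<phi>"

lemma subforms_refl [simp]: "\<phi> \<in> set (subforms \<phi>)"
  by (cases \<phi>) auto

lemma subforms_trans:
  "\<psi> \<in> set (subforms \<phi>) \<Longrightarrow> set (subforms \<psi>) \<subseteq> set (subforms \<phi>)"
  by (induction \<phi>) auto

text \<open>With these two belief formulas present every atom decides them; \<open>N\<close> and
  \<open>BF\<close> then settle that a cell is one of its own neighborhoods and that the empty set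
  is none.\<close>

locale closed_list =
  fixes l :: "'p form list"
  assumes closed: "\<psi> \<in> set l \<Longrightarrow> set (subforms \<psi>) \<subseteq> set l"
    and B_Top: "B \<^bold>\<top> \<in> set l" and B_Bot: "B \<^bold>\<bottom> \<in> set l"
begin

definition atoms :: "'p form set set" where
  "atoms = {a. a \<subseteq> set l \<and> consistent (conjs (lits a l))}"

lemma finite_atoms: "finite atoms"
  by (rule finite_subset[of _ "Pow (set l)"]) (auto simp: atoms_def)

text \<open>Consistency gives a valuation \<open>h\<close> that matches the atom on \<open>l\<close>
  and satisfies the chosen theorem, so each theorem becomes a closure property of atoms.\<close>

lemma atom_valuation:
  assumes "a \<in> atoms" and "\<turnstile>\<^sub>K\<^sub>B \<phi>"
    and "\<And>h. bool_eval h \<phi> \<Longrightarrow> (\<And>s. s \<in> set l \<Longrightarrow> s \<in> a \<longleftrightarrow> bool_eval h s) \<Longrightarrow> P"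
  shows P
  using consistent_with_theorem[OF _ assms(2)] assms(1,3) by (force simp: atoms_def)

text \<open>The Boolean clause comes from the matching valuation; \<open>BF\<close> merely serves as
  some theorem to instantiate \<open>atom_valuation\<close>.\<close>

lemma atom_neg: "a \<in> atoms \<Longrightarrow> \<^bold>\<not> \<phi> \<in> set l \<Longrightarrow> \<^bold>\<not> \<phi> \<in> a \<longleftrightarrow> \<phi> \<notin> a"
  using closed[of "\<^bold>\<not> \<phi>"] subforms_refl[of \<phi>]
  by (elim atom_valuation[OF _ BF]) (metis bool_eval.simps(3) list.set_intros(2) subforms.simps(3) subsetD)

lemma atom_and: "a \<in> atoms \<Longrightarrow> \<phi> \<^bold>\<and> \<psi> \<in> set l \<Longrightarrow> \<phi> \<^bold>\<and> \<psi> \<in> a \<longleftrightarrow> \<phi> \<in> a \<and> \<psi> \<in> a"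
  using closed[of "\<phi> \<^bold>\<and> \<psi>"] subforms_refl[of \<phi>] subforms_refl[of \<psi>]
  by (elim atom_valuation[OF _ BF]) (metis Un_iff bool_eval.simps(4) list.set_intros(2) set_append
      subforms.simps(4) subsetD)

lemma Top_in: "\<^bold>\<top> \<in> set l"
  using closed[OF B_Bot] by auto

lemma atom_Top: "a \<in> atoms \<Longrightarrow> \<^bold>\<top> \<in> a"
  by (erule atom_valuation[OF _ BF]) (use Top_in in auto)

lemma atom_B_Top: "a \<in> atoms \<Longrightarrow> B \<^bold>\<top> \<in> a"
  by (erule atom_valuation[OF _ N]) (use B_Top in auto)

lemma atom_B_Bot: "a \<in> atoms \<Longrightarrow> B \<^bold>\<bottom> \<notin> a"
  by (erule atom_valuation[OF _ BF]) (use B_Bot in auto)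

lemma atom_K_refl:
  assumes "a \<in> atoms" "K \<psi> \<in> a"
  shows "\<psi> \<in> a"
proof (rule atom_valuation[OF assms(1) KT[of \<psi>]])
  fix h
  assume h: "bool_eval h (K \<psi> \<^bold>\<longrightarrow> \<psi>)" and eq: "\<And>s. s \<in> set l \<Longrightarrow> s \<in> a \<longleftrightarrow> bool_eval h s"
  have l: "K \<psi> \<in> set l" using assms by (auto simp: atoms_def)
  then have "\<psi> \<in> set l" using closed[OF l] by auto
  then show "\<psi> \<in> a" using h eq[of \<psi>] eq[OF l] assms(2) by auto
qed

section \<open>Cells of atoms and provable knowledge\<close>

definition agree :: "'p form set \<Rightarrow> 'p form set \<Rightarrow> bool" where
  "agree a b \<longleftrightarrow> (\<forall>s\<in>set l. modal s \<longrightarrow> (s \<in> a \<longleftrightarrow> s \<in> b))"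

text \<open>One valuation satisfies the modal part of \<open>a\<close>, \<theta> and the literals of
  the extension \<open>b\<close>, so \<open>b\<close> shares the modal formulas of \<open>a\<close>.
  The valuation is returned because \<theta> need not belong to \<open>l\<close>.\<close>

lemma consistent_obtain_atom:
  assumes "consistent (modal_part l a \<^bold>\<and> \<theta>)"
  obtains b h where "b \<in> atoms" and "agree a b" and "bool_eval h \<theta>"
    and "\<And>s. s \<in> set l \<Longrightarrow> s \<in> b \<longleftrightarrow> bool_eval h s"
proof -
  obtain b where b: "b \<subseteq> set l" "consistent ((modal_part l a \<^bold>\<and> \<theta>) \<^bold>\<and> conjs (lits b l))"
    using consistent_extend_lits[OF assms] by blast
  then have "b \<in> atoms" by (auto simp: atoms_def elim: consistent_weaken)
  moreover obtain h where "bool_eval h (modal_part l a)" "bool_eval h \<theta>"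
      "\<forall>s\<in>set l. bool_eval h s \<longleftrightarrow> s \<in> b"
    using consistent_with_theorem[OF b(2) BF] by auto
  moreover from this have "agree a b" by (auto simp: modal_part_def agree_def)
  ultimately show ?thesis using that by blast
qed

text \<open>If the modal part were consistent with \<chi> and the negation of \<psi>, some atom of
  the cell would contain \<chi> but not \<psi>. So it proves the implication and, entailing its own
  knowledge, proves it known.\<close>

lemma cell_imp_K:
  assumes "\<chi> \<in> set l" "\<psi> \<in> set l"
    and "\<And>b. b \<in> atoms \<Longrightarrow> agree a b \<Longrightarrow> \<chi> \<in> b \<Longrightarrow> \<psi> \<in> b"
  shows "\<turnstile>\<^sub>K\<^sub>B modal_part l a \<^bold>\<longrightarrow> K (\<chi> \<^bold>\<longrightarrow> \<psi>)"
proof -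
  have "\<not> consistent (modal_part l a \<^bold>\<and> (\<chi> \<^bold>\<and> \<^bold>\<not> \<psi>))"
  proof
    assume "consistent (modal_part l a \<^bold>\<and> (\<chi> \<^bold>\<and> \<^bold>\<not> \<psi>))"
    then show False by (rule consistent_obtain_atom) (use assms in auto)
  qed
  then have "\<turnstile>\<^sub>K\<^sub>B \<^bold>\<not> (modal_part l a \<^bold>\<and> (\<chi> \<^bold>\<and> \<^bold>\<not> \<psi>))" by (simp add: consistent_def)
  then have "\<turnstile>\<^sub>K\<^sub>B modal_part l a \<^bold>\<longrightarrow> (\<chi> \<^bold>\<longrightarrow> \<psi>)" by (rule derive_taut1) auto
  then have "\<turnstile>\<^sub>K\<^sub>B K (modal_part l a) \<^bold>\<longrightarrow> K (\<chi> \<^bold>\<longrightarrow> \<psi>)" by (rule derive_K_mono)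
  with modal_part_imp_K[of l a] show ?thesis by (rule derive_taut2) auto
qed

text \<open>This is \<open>cell_imp_K\<close> with \<chi> taken as truth; the atom satisfies its own
  modal part and hence contains the conclusion.\<close>

lemma cell_K:
  assumes "a \<in> atoms" "K \<psi> \<in> set l" and "\<And>b. b \<in> atoms \<Longrightarrow> agree a b \<Longrightarrow> \<psi> \<in> b"
  shows "K \<psi> \<in> a"
proof -
  have "\<psi> \<in> set l" using closed[OF assms(2)] by auto
  then have 1: "\<turnstile>\<^sub>K\<^sub>B modal_part l a \<^bold>\<longrightarrow> K (\<^bold>\<top> \<^bold>\<longrightarrow> \<psi>)"
    using Top_in assms(3) by (intro cell_imp_K) auto
  have "\<turnstile>\<^sub>K\<^sub>B (\<^bold>\<top> \<^bold>\<longrightarrow> \<psi>) \<^bold>\<longrightarrow> \<psi>" by (rule CL) (simp add: tautology_def)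
  from derive_K_mono[OF this] have "\<turnstile>\<^sub>K\<^sub>B modal_part l a \<^bold>\<longrightarrow> K \<psi>"
    by (rule derive_taut2[OF 1]) auto
  then show ?thesis
    by (rule atom_valuation[OF assms(1)]) (use assms(2) in \<open>auto simp: modal_part_def\<close>)
qed

text \<open>\<open>KBM\<close> turns the known implication into one between beliefs. This keeps the
  truth set of a formula of \<open>l\<close> that is not believed out of the neighborhoods.\<close>

lemma cell_B:
  assumes "a \<in> atoms" "B \<psi> \<in> set l" "B \<chi> \<in> a"
    and "\<And>b. b \<in> atoms \<Longrightarrow> agree a b \<Longrightarrow> \<chi> \<in> b \<Longrightarrow> \<psi> \<in> b"
  shows "B \<psi> \<in> a"
proof -
  have l: "B \<chi> \<in> set l" using assms(1,3) by (auto simp: atoms_def)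
  have "\<chi> \<in> set l" "\<psi> \<in> set l" using closed[OF l] closed[OF assms(2)] by auto
  then have "\<turnstile>\<^sub>K\<^sub>B modal_part l a \<^bold>\<longrightarrow> K (\<chi> \<^bold>\<longrightarrow> \<psi>)"
    using assms(4) by (intro cell_imp_K) auto
  then have "\<turnstile>\<^sub>K\<^sub>B modal_part l a \<^bold>\<longrightarrow> (B \<chi> \<^bold>\<longrightarrow> B \<psi>)"
    by (rule derive_taut2[OF _ KBM]) auto
  then show ?thesis
    by (rule atom_valuation[OF assms(1)]) (use assms(2,3) l in \<open>auto simp: modal_part_def\<close>)
qed

section \<open>The finite canonical model\<close>

text \<open>Enumerating the atoms by \<open>e\<close>, possibly with repetitions, makes the worlds natural numbers.\<close>

definition canonical :: "nat \<Rightarrow> (nat \<Rightarrow> 'p form set) \<Rightarrow> (nat, 'p) nmodel" where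
  "canonical n e = \<lparr>worlds = {..<n}, rel = {(i, j). i < n \<and> j < n \<and> agree (e i) (e j)},
     val = (\<lambda>i. {p. Letter p \<in> e i}),
     nbhd = (\<lambda>i. {X. X \<subseteq> {j. j < n \<and> agree (e i) (e j)} \<and>
       (\<exists>\<chi>. B \<chi> \<in> e i \<and> {j. j < n \<and> agree (e i) (e j) \<and> \<chi> \<in> e j} \<subseteq> X)})\<rparr>"

lemma canonical_cell: "i < n \<Longrightarrow> cell (canonical n e) i = {j. j < n \<and> agree (e i) (e j)}"
  by (auto simp: canonical_def cell_def)

lemma canonical_nbhd:
  "X \<in> nbhd (canonical n e) i \<longleftrightarrow> X \<subseteq> {j. j < n \<and> agree (e i) (e j)} \<and>
     (\<exists>\<chi>. B \<chi> \<in> e i \<and> {j. j < n \<and> agree (e i) (e j) \<and> \<chi> \<in> e j} \<subseteq> X)"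
  by (simp add: canonical_def)

text \<open>Closure under supersets within the cell is built into the neighborhoods, and their
  constancy on cells holds because agreeing atoms have the same beliefs and the same cell.\<close>

lemma canonical_model:
  assumes e: "e ` {..<n} = atoms" and "n > 0"
  shows "epistemic_nbhd_model (canonical n e)"
proof -
  have atom: "e i \<in> atoms" if "i < n" for i using e that by auto
  \<comment> \<open>\<open>agree\<close> compares only members of \<open>l\<close>, but atoms are
    subsets of \<open>l\<close>, so it covers every belief in either atom.\<close>
  have B_agree: "B \<chi> \<in> e i \<longleftrightarrow> B \<chi> \<in> e j" if "agree (e i) (e j)" "i < n" "j < n" for i j \<chi>
  proof -
    have "B \<chi> \<in> set l" if "B \<chi> \<in> e i \<union> e j"
      using that atom[OF \<open>i < n\<close>] atom[OF \<open>j < n\<close>] by (auto simp: atoms_def)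
    then show ?thesis using that(1) by (auto simp: agree_def)
  qed
  have trans: "agree (e i) (e k) \<longleftrightarrow> agree (e j) (e k)" if "agree (e i) (e j)" for i j k
    using that by (auto simp: agree_def)
  let ?M = "canonical n e"
  have worlds: "worlds ?M = {..<n}" by (simp add: canonical_def)
  show ?thesis
    unfolding epistemic_nbhd_model_def
  proof (intro conjI ballI allI impI)
    show "finite (worlds ?M)" "worlds ?M \<noteq> {}" using \<open>n > 0\<close> by (auto simp: worlds)
    show "equiv (worlds ?M) (rel ?M)"
      by (rule equivI) (auto simp: canonical_def agree_def refl_on_def sym_def trans_def)
  next
    fix i assume "i \<in> worlds ?M"
    then have i: "i < n" by (simp add: worlds)
    show "nbhd ?M i \<subseteq> Pow (worlds ?M)" by (auto simp: canonical_nbhd worlds)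
    \<comment> \<open>The cell contains the truth set of any believed formula, and
      \<open>atom_B_Top\<close> provides a believed one.\<close>
    show "cell ?M i \<in> nbhd ?M i"
      unfolding canonical_cell[OF i] canonical_nbhd using atom_B_Top[OF atom[OF i]] by blast
    show "{} \<notin> nbhd ?M i"
    proof
      assume "{} \<in> nbhd ?M i"
      then obtain \<chi> where "B \<chi> \<in> e i" "\<And>j. j < n \<Longrightarrow> agree (e i) (e j) \<Longrightarrow> \<chi> \<notin> e j"
        unfolding canonical_nbhd by blast
      \<comment> \<open>A believed \<chi> false throughout the cell vacuously implies falsity there,
        so \<open>cell_B\<close> makes falsity believed.\<close>
      then have "B \<^bold>\<bottom> \<in> e i"
        using i B_Bot by - (rule cell_B[of _ _ \<chi>], auto simp flip: e)
      then show False using atom_B_Bot atom i by blast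
    qed
  next
    fix i X assume "i \<in> worlds ?M" "X \<in> nbhd ?M i"
    then show "X \<subseteq> cell ?M i" by (simp add: worlds canonical_cell canonical_nbhd)
  next
    fix i j assume "i \<in> worlds ?M" "j \<in> cell ?M i"
    then have *: "agree (e i) (e j)" "i < n" "j < n" by (simp_all add: worlds canonical_cell)
    show "nbhd ?M j = nbhd ?M i"
      using B_agree[OF *] trans[OF *(1)] by (simp add: canonical_def)
  next
    fix i X Y assume "i \<in> worlds ?M" and *: "X \<subseteq> Y \<and> Y \<subseteq> cell ?M i \<and> X \<in> nbhd ?M i"
    then have i: "i < n" by (simp add: worlds)
    show "Y \<in> nbhd ?M i" using * unfolding canonical_cell[OF i] canonical_nbhd by blast
  qed
qed

section \<open>Truth lemma and completeness\<close>

text \<open>The modal cases rest on \<open>cell_K\<close> with \<open>atom_K_refl\<close>, and on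
  \<open>cell_B\<close>, which replaces any \<chi> witnessing a neighborhood by \<psi>
  itself.\<close>

lemma truth:
  assumes e: "e ` {..<n} = atoms" and "\<psi> \<in> set l" and "i < n"
  shows "(canonical n e, i \<Turnstile>\<^sub>n \<psi>) \<longleftrightarrow> \<psi> \<in> e i"
proof -
  have atom: "e i \<in> atoms" if "i < n" for i using e that by auto
  show ?thesis using assms(2,3)
  proof (induction \<psi> arbitrary: i)
    case Top
    then show ?case using atom_Top[OF atom] by simp
  next
    case (Letter p)
    then show ?case by (simp add: canonical_def)
  next
    case (Neg \<psi>)
    have "\<psi> \<in> set l" using closed[OF Neg.prems(1)] by auto
    then show ?case using atom_neg[OF atom Neg.prems(1)] Neg by simp
  next
    case (And \<psi>1 \<psi>2)
    have "\<psi>1 \<in> set l" "\<psi>2 \<in> set l" using closed[OF And.prems(1)] by auto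
    then show ?case using atom_and[OF atom And.prems(1)] And by simp
  next
    case (K \<psi>)
    have "\<psi> \<in> set l" using closed[OF K.prems(1)] by auto
    with K have IH: "\<And>j. j < n \<Longrightarrow> (canonical n e, j \<Turnstile>\<^sub>n \<psi>) \<longleftrightarrow> \<psi> \<in> e j" by blast
    have "(canonical n e, i \<Turnstile>\<^sub>n K \<psi>) \<longleftrightarrow> (\<forall>j<n. agree (e i) (e j) \<longrightarrow> \<psi> \<in> e j)"
      using IH by (auto simp: canonical_cell[OF K.prems(2)]) (auto simp: canonical_def)
    also have "\<dots> \<longleftrightarrow> K \<psi> \<in> e i"
    proof
      assume "\<forall>j<n. agree (e i) (e j) \<longrightarrow> \<psi> \<in> e j"
      \<comment> \<open>Every atom is some \<open>e j\<close>, so the assumption about indices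
        covers all atoms agreeing with \<open>e i\<close>.\<close>
      then show "K \<psi> \<in> e i"
        using K.prems by - (rule cell_K, auto simp flip: e)
    next
      assume "K \<psi> \<in> e i"
      then have "K \<psi> \<in> e j" if "agree (e i) (e j)" for j
        using that K.prems(1) by (auto simp: agree_def)
      then show "\<forall>j<n. agree (e i) (e j) \<longrightarrow> \<psi> \<in> e j" using atom_K_refl[OF atom] by blast
    qed
    finally show ?case .
  next
    case (B \<psi>)
    have "\<psi> \<in> set l" using closed[OF B.prems(1)] by auto
    with B have IH: "\<And>j. j < n \<Longrightarrow> (canonical n e, j \<Turnstile>\<^sub>n \<psi>) \<longleftrightarrow> \<psi> \<in> e j" by blast
    have "cell (canonical n e) i \<inter> {v \<in> worlds (canonical n e). canonical n e, v \<Turnstile>\<^sub>n \<psi>}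
        = {j. j < n \<and> agree (e i) (e j) \<and> \<psi> \<in> e j}"
      using IH by (auto simp: canonical_cell[OF B.prems(2)]) (auto simp: canonical_def)
    then have "(canonical n e, i \<Turnstile>\<^sub>n B \<psi>) \<longleftrightarrow>
        {j. j < n \<and> agree (e i) (e j) \<and> \<psi> \<in> e j} \<in> nbhd (canonical n e) i" by simp
    also have "\<dots> \<longleftrightarrow>
        (\<exists>\<chi>. B \<chi> \<in> e i \<and> (\<forall>j<n. agree (e i) (e j) \<longrightarrow> \<chi> \<in> e j \<longrightarrow> \<psi> \<in> e j))"
      unfolding canonical_nbhd by blast
    also have "\<dots> \<longleftrightarrow> B \<psi> \<in> e i"
    proof
      assume "\<exists>\<chi>. B \<chi> \<in> e i \<and> (\<forall>j<n. agree (e i) (e j) \<longrightarrow> \<chi> \<in> e j \<longrightarrow> \<psi> \<in> e j)"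
      then obtain \<chi> where "B \<chi> \<in> e i" "\<forall>j<n. agree (e i) (e j) \<longrightarrow> \<chi> \<in> e j \<longrightarrow> \<psi> \<in> e j"
        by blast
      then show "B \<psi> \<in> e i"
        using B.prems by - (rule cell_B[of _ _ \<chi>], auto simp flip: e)
    \<comment> \<open>Conversely, \<psi> is its own witness \<chi>.\<close>
    qed blast
    finally show ?case .
  qed
qed

text \<open>If \<phi> is unprovable, its negation is consistent and extends to an atom omitting
  \<phi>; the truth lemma makes this a refuting world.\<close>

lemma completeness:
  assumes "\<phi> \<in> set l" and valid: "valid_over TYPE(nat) \<phi>"
  shows "\<turnstile>\<^sub>K\<^sub>B \<phi>"
proof (rule ccontr)
  assume not: "\<not> \<turnstile>\<^sub>K\<^sub>B \<phi>"
  have "consistent (\<^bold>\<not> \<phi>)"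
    using not derive_taut1[of "\<^bold>\<not> \<^bold>\<not> \<phi>" \<phi>] by (auto simp: consistent_def)
  then obtain a where a: "a \<subseteq> set l" "consistent (\<^bold>\<not> \<phi> \<^bold>\<and> conjs (lits a l))"
    using consistent_extend_lits by blast
  then have "a \<in> atoms" by (auto simp: atoms_def elim: consistent_weaken)
  moreover have "\<phi> \<notin> a"
    using consistent_with_theorem[OF a(2) BF] assms(1) by auto
  \<comment> \<open>A finite set is the image of an initial segment of the naturals; the index found
    for \<open>a\<close> also shows that the segment is nonempty.\<close>
  moreover obtain n :: nat and e where e: "e ` {..<n} = atoms"
    using finite_atoms unfolding finite_conv_nat_seg_image lessThan_def by auto
  ultimately obtain i where i: "i < n" "\<phi> \<notin> e i" by blast
  then have "epistemic_nbhd_model (canonical n e)" using canonical_model[OF e] by simp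
  moreover have "i \<in> worlds (canonical n e)" using i by (simp add: canonical_def)
  ultimately have "canonical n e, i \<Turnstile>\<^sub>n \<phi>" using valid by (auto simp: valid_over_def)
  then show False using truth[OF e assms(1)] i by blast
qed

end

theorem mainTheorem7:
  fixes \<phi> :: "'p form"
  shows "((\<turnstile>\<^sub>K\<^sub>B \<phi>) \<longleftrightarrow> valid_over TYPE(nat) \<phi>) \<and>
         ((\<turnstile>\<^sub>K\<^sub>B \<phi>) \<longrightarrow> valid_over TYPE('w) \<phi>)"
proof -
  \<comment> \<open>Conjoining the two belief formulas puts them among the subformulas, giving a
    single closed list that also contains \<phi>.\<close>
  let ?\<theta> = "\<phi> \<^bold>\<and> (B \<^bold>\<top> \<^bold>\<and> B \<^bold>\<bottom>)"
  interpret closed_list "subforms ?\<theta>"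
    by unfold_locales (rule subforms_trans, auto)
  have "valid_over TYPE(nat) \<phi> \<Longrightarrow> \<turnstile>\<^sub>K\<^sub>B \<phi>" by (rule completeness) simp_all
  moreover have "\<turnstile>\<^sub>K\<^sub>B \<phi> \<Longrightarrow> valid_over TYPE(nat) \<phi>" and "\<turnstile>\<^sub>K\<^sub>B \<phi> \<Longrightarrow> valid_over TYPE('w) \<phi>"
    by (simp_all add: valid_over_def soundness)
  ultimately show ?thesis by blast
qed

end
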